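(* Let $k$ be a positive integer and let $G$ be a connected graph with $n \geq 2k+2$ vertices such that $d_G(x) + d_G(y) \geq n + k$ for all $xy \in E(G)$. Then $G$ contains at least $(k+1)n - \binom{k+2}{2}$ edges.
   Context: Graphs are finite and simple; $d_G(x)$ denotes the degree of the vertex $x$ in $G$. *)

theory Defs
  imports "Graph_Theory.Graph_Theory"
begin

text \<open>
  A finite simple graph is a \<^locale>\<open>pair_graph\<close>: a finite, loop-free, symmetric set of arcs
  without parallel arcs. Each edge \<open>xy\<close> is represented by the two arcs \<open>(x, y)\<close> and \<open>(y, x)\<close>, so
  edges are counted as unordered pairs.
\<close>

definition graph_edges :: "'a pair_pre_digraph \<Rightarrow> 'a set set" where
  "graph_edges G = (\<lambda>(x, y). {x, y}) ` parcs G"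

abbreviation graph_degree :: "'a pair_pre_digraph \<Rightarrow> 'a \<Rightarrow> nat" where
  "graph_degree G x \<equiv> out_degree (with_proj G) x"

lemma (in pair_graph) degree_eq_card_incident_edges:
  "graph_degree G x = card {e \<in> graph_edges G. x \<in> e}"
proof -
  have sym: "(v, u) \<in> parcs G" if "(u, v) \<in> parcs G" for u v
    using arcs_ends_symmetric[OF pair_sym_arcs] that by simp
  have "bij_betw (\<lambda>(x, y). {x, y}) (out_arcs (with_proj G) x) {e \<in> graph_edges G. x \<in> e}"
    unfolding bij_betw_def
  proof
    show "inj_on (\<lambda>(x, y). {x, y}) (out_arcs (with_proj G) x)"
      by (auto simp: inj_on_def out_arcs_def doubleton_eq_iff)
    show "(\<lambda>(x, y). {x, y}) ` out_arcs (with_proj G) x = {e \<in> graph_edges G. x \<in> e}"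
      unfolding graph_edges_def out_arcs_def
      by (auto simp: image_iff dest: sym intro: rev_bexI)
  qed
  then show ?thesis
    unfolding out_degree_def by (rule bij_betw_same_card)
qed

end

theory Submission
  imports Defs
begin

text \<open>
  Everything follows from looking at one vertex \<open>v\<close> of minimum degree \<open>d\<close>. By connectedness every
  vertex has a neighbour, whose degree is at most \<open>n - 1\<close>; the degree condition on that edge gives
  \<open>d \<ge> k + 1\<close>. Each of the \<open>d\<close> neighbours of \<open>v\<close> has degree at least \<open>n + k - d\<close>, and each of the
  other \<open>n - d\<close> vertices has degree at least \<open>d\<close>, so the handshake lemma yields
  \<open>2 |E| \<ge> d (n + k - d) + (n - d) d = d (2n + k - 2d)\<close>.

  Twice the claimed bound is \<open>(k + 1) (2n - k - 2)\<close>, which is the value of this concave quadratic at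
  \<open>d = k + 1\<close>. The quadratic takes that value again at \<open>n - 1 - k/2\<close>, so the claim holds whenever
  \<open>k + 1 \<le> d \<le> n - 1 - k/2\<close>. For larger \<open>d\<close> the crude bound \<open>2 |E| \<ge> n d\<close> suffices, and this is
  where \<open>n \<ge> 2k + 2\<close> enters. The bound is attained by the join of a complete graph on \<open>k + 1\<close>
  vertices with \<open>n - k - 1\<close> independent vertices.
\<close>

context pair_graph
begin

lemma graph_edges_iff: "{x, y} \<in> graph_edges G \<longleftrightarrow> (x, y) \<in> parcs G"
  unfolding graph_edges_def by (auto simp: doubleton_eq_iff intro: arcs_symmetric rev_image_eqI)

lemma graph_degree_eq_card_neighbours: "graph_degree G x = card {y. (x, y) \<in> parcs G}"
proof -
  have "out_arcs (with_proj G) x = Pair x ` {y. (x, y) \<in> parcs G}"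
    by (auto simp: out_arcs_def)
  then show ?thesis
    unfolding out_degree_def by (simp add: card_image inj_on_def)
qed

lemma graph_degree_less_order:
  assumes "x \<in> pverts G"
  shows "graph_degree G x < card (pverts G)"
proof -
  have "{y. (x, y) \<in> parcs G} \<subseteq> pverts G - {x}"
    by (auto dest: in_arcsD2 no_loops')
  then have "graph_degree G x \<le> card (pverts G - {x})"
    unfolding graph_degree_eq_card_neighbours by (intro card_mono) (auto simp: pair_finite_verts)
  also have "\<dots> < card (pverts G)"
    using assms by (intro psubset_card_mono) (auto simp: pair_finite_verts)
  finally show ?thesis .
qed

lemma handshake: "(\<Sum>x\<in>pverts G. graph_degree G x) = 2 * card (graph_edges G)"
proof -
  have "card {x \<in> pverts G. x \<in> e} = 2" if "e \<in> graph_edges G" for e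
  proof -
    from that obtain x y where xy: "e = {x, y}" "(x, y) \<in> parcs G"
      unfolding graph_edges_def by auto
    then have "{x \<in> pverts G. x \<in> e} = {x, y}"
      by (auto dest: in_arcsD1 in_arcsD2)
    with xy show ?thesis
      by (auto dest: no_loops')
  qed
  then have "(\<Sum>x\<in>pverts G. card {e \<in> graph_edges G. x \<in> e}) = 2 * card (graph_edges G)"
    by (intro sum_multicount) (auto simp: pair_finite_verts pair_finite_arcs graph_edges_def)
  then show ?thesis
    by (simp only: degree_eq_card_incident_edges)
qed

lemma connected_has_neighbour:
  assumes "connected (with_proj G)" and "x \<in> pverts G" and "card (pverts G) \<ge> 2"
  obtains y where "(x, y) \<in> parcs G"
proof -
  have "pverts G \<noteq> {x}"
    using assms(3) by auto
  then obtain z where z: "z \<in> pverts G" "z \<noteq> x"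
    using assms(2) by blast
  have "strongly_connected (with_proj G)"
    using symmetric_connected_imp_strongly_connected[OF pair_sym_arcs assms(1)] .
  then have "x \<rightarrow>\<^sup>*\<^bsub>with_proj G\<^esub> z"
    using assms(2) z(1) by (simp add: strongly_connected_def)
  then show thesis
    using z(2) that by (cases rule: converse_reachable_cases) auto
qed

text \<open>
  This is the basic estimate for the edge number: the vertices are split into the neighbours of
  \<open>v\<close>, whose degrees are large when that of \<open>v\<close> is small, and all others.
\<close>

lemma degree_sum_ge_at_min_degree_vertex:
  assumes v: "v \<in> pverts G"
    and min: "\<And>x. x \<in> pverts G \<Longrightarrow> graph_degree G v \<le> graph_degree G x"
    and nbr: "\<And>y. (v, y) \<in> parcs G \<Longrightarrow> s \<le> graph_degree G y"
  shows "graph_degree G v * s + (card (pverts G) - graph_degree G v) * graph_degree G v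
    \<le> (\<Sum>x\<in>pverts G. graph_degree G x)"
proof -
  define N where "N = {y. (v, y) \<in> parcs G}"
  have N: "N \<subseteq> pverts G" "finite N" "card N = graph_degree G v"
    unfolding graph_degree_eq_card_neighbours N_def
    by (auto dest: in_arcsD2 intro: finite_subset[OF _ pair_finite_verts])
  have "card N * s \<le> (\<Sum>x\<in>N. graph_degree G x)"
    using sum_bounded_below[of N s "graph_degree G"] nbr by (simp add: N_def)
  moreover have "card (pverts G - N) * graph_degree G v \<le> (\<Sum>x\<in>pverts G - N. graph_degree G x)"
    using sum_bounded_below[of "pverts G - N" "graph_degree G v" "graph_degree G"] min by simp
  moreover have "(\<Sum>x\<in>pverts G. graph_degree G x)
      = (\<Sum>x\<in>pverts G - N. graph_degree G x) + (\<Sum>x\<in>N. graph_degree G x)"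
    using N pair_finite_verts by (intro sum.subset_diff)
  ultimately show ?thesis
    using N by (simp add: card_Diff_subset)
qed

end

text \<open>
  The split bound exceeds the claimed one by exactly \<open>(d - k - 1) (2n - k - 2 - 2d)\<close>, which settles
  the case \<open>2d \<le> 2n - k - 2\<close>. Otherwise \<open>2nd \<ge> n (2n - k - 2) \<ge> 2 (k + 1) (2n - k - 2)\<close>, and the
  crude bound is enough.
\<close>

lemma edge_bound_from_min_degree:
  fixes d k n S :: int
  assumes "k \<ge> 0" and "n \<ge> 2 * k + 2" and "d \<ge> k + 1"
    and split: "S \<ge> d * (n + k - d) + (n - d) * d" and crude: "S \<ge> n * d"
  shows "S \<ge> (k + 1) * (2 * n - k - 2)"
proof (cases "2 * d \<le> 2 * n - k - 2")
  case True
  then have "0 \<le> (d - k - 1) * (2 * n - k - 2 - 2 * d)"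
    using assms(3) by (intro mult_nonneg_nonneg) auto
  then show ?thesis
    using split by (simp add: algebra_simps)
next
  case False
  then have "n * (2 * n - k - 2) \<le> n * (2 * d)"
    using assms by (intro mult_left_mono) auto
  moreover have "(2 * k + 2) * (2 * n - k - 2) \<le> n * (2 * n - k - 2)"
    using assms by (intro mult_right_mono) auto
  ultimately show ?thesis
    using crude by (simp add: algebra_simps)
qed

lemma twice_choose_two: "2 * int (m choose 2) = int m * (int m - 1)"
proof -
  have "2 * (m choose 2) = m * (m - 1)"
    by (cases m) (simp_all add: choose_two)
  then have "2 * int (m choose 2) = int (m * (m - 1))"
    by (metis of_nat_mult of_nat_numeral)
  then show ?thesis
    by (cases m) (simp_all add: algebra_simps)
qed

theorem theorem7:
  fixes G :: "'a pair_pre_digraph" and k n :: nat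
  assumes "k \<ge> 1"
    and "pair_graph G"
    and "Digraph_Component.connected (with_proj G)"
    and "card (pverts G) = n"
    and "n \<ge> 2 * k + 2"
    and "\<And>x y. {x, y} \<in> graph_edges G \<Longrightarrow> graph_degree G x + graph_degree G y \<ge> n + k"
  shows "int (card (graph_edges G)) \<ge> (int k + 1) * int n - int ((k + 2) choose 2)"
proof -
  interpret pair_graph G by fact
  have deg_sum: "n + k \<le> graph_degree G x + graph_degree G y" if "(x, y) \<in> parcs G" for x y
    using assms(6) that by (simp add: graph_edges_iff)
  have "pverts G \<noteq> {}"
    using assms(4,5) by auto
  then obtain v where v: "v \<in> pverts G"
    and min: "\<And>x. x \<in> pverts G \<Longrightarrow> graph_degree G v \<le> graph_degree G x"
    using pair_finite_verts by (metis (mono_tags, lifting) arg_min_if_finite(1) arg_min_least)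
  define d where "d = graph_degree G v"
  define S where "S = (\<Sum>x\<in>pverts G. graph_degree G x)"
  have dn: "d < n"
    using graph_degree_less_order[OF v] assms(4) by (simp add: d_def)
  obtain y where y: "(v, y) \<in> parcs G"
    using connected_has_neighbour[OF assms(3) v] assms(4,5) by auto
  have "graph_degree G y < n"
    using graph_degree_less_order[OF in_arcsD2[OF y]] assms(4) by simp
  then have dk: "k + 1 \<le> d"
    using deg_sum[OF y] by (simp add: d_def)
  have "d * (n + k - d) + (n - d) * d \<le> S"
    unfolding S_def d_def assms(4)[symmetric]
    using v min
  proof (rule degree_sum_ge_at_min_degree_vertex)
    show "card (pverts G) + k - graph_degree G v \<le> graph_degree G z" if "(v, z) \<in> parcs G" for z
      using deg_sum[OF that] assms(4) by simp
  qed
  then have "int (d * (n + k - d) + (n - d) * d) \<le> int S"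
    by (simp only: of_nat_le_iff)
  then have split: "int d * (int n + int k - int d) + (int n - int d) * int d \<le> int S"
    using dn by (simp add: of_nat_diff)
  have "n * d \<le> S"
    unfolding S_def using sum_bounded_below[of "pverts G" d "graph_degree G"] min assms(4)
    by (simp add: d_def)
  then have crude: "int n * int d \<le> int S"
    by (metis of_nat_le_iff of_nat_mult)
  have "(int k + 1) * (2 * int n - int k - 2) \<le> int S"
    using edge_bound_from_min_degree[OF _ _ _ split crude] dk assms(5) by simp
  moreover have "int S = 2 * int (card (graph_edges G))"
    using handshake by (simp add: S_def)
  moreover have "2 * int ((k + 2) choose 2) = (int k + 2) * (int k + 1)"
    using twice_choose_two[of "k + 2"] by (simp add: algebra_simps)
  ultimately show ?thesis
    by (simp add: algebra_simps)
qed

end
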